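(* For every $a>0$, $c>0$, $\mu\ge 0$ there exist constants $\omega, G, \gamma_1, \gamma_2>0$ such that the following holds. Let $f\in C^0(\mathbb{R}_+;L^2(0,1))\cap C^0((0,+\infty)\times(0,1))$ and $d\in C^0(\mathbb{R}_+)$ be arbitrary inputs, and let $u\in C^1(\mathbb{R}_+\times[0,1])\cap C^2((0,+\infty)\times(0,1))$ be any solution of $$u_{tt}(t,x)=c^2u_{xx}(t,x)-\mu u_t(t,x)+f(t,x),\quad t>0,\ x\in(0,1),$$ $$u(t,0)=0,\quad t>0,$$ $$u_x(t,1)=-a\,u_t(t,1)+d(t),\quad t>0.$$ Then for all $t\ge 0$, $$\left(\|u_t[t]\|_2^2+\|u_x[t]\|_2^2\right)^{1/2}\le G\exp(-\omega t)\left(\|u_t[0]\|_2^2+\|u_x[0]\|_2^2\right)^{1/2}+\gamma_1\sup_{0\le s\le t}\left(\|f[s]\|_2\right)+\gamma_2\sup_{0\le s\le t}\left(|d(s)|\right).$$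
   Context: $\mathbb{R}_+=[0,+\infty)$. All functions are real-valued. For an open set $S\subseteq\mathbb{R}^n$ and a set $A$ with $S\subseteq A\subseteq \mathrm{cl}(S)$, $C^0(A)$ is the class of continuous functions on $A$, and $C^k(A)$ ($k\ge1$) is the class of functions on $A$ that have continuous derivatives up to order $k$ in $S=\mathrm{int}(A)$ which can be continued continuously to all points of $\partial S\cap A$ (the values of derivatives at such points are these continuous extensions). For an interval $I$ and a normed space $Y$, $C^0(I;Y)$ is the class of continuous functions $I\to Y$. For a function $w$ of $(t,x)$, $w[t]$ denotes the profile $x\mapsto w(t,x)$, $x\in[0,1]$; subscripts $t,x$ denote partial derivatives. $\|\cdot\|_2$ is the norm of $L^2(0,1)$: $\|v\|_2=\left(\int_0^1|v(x)|^2dx\right)^{1/2}$. The constants $\omega,G,\gamma_1,\gamma_2$ depend only on $a,c,\mu$ and not on $u,f,d$. *)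

theory Defs
  imports "HOL-Analysis.Analysis"
begin

definition partial_deriv :: "'a::euclidean_space \<Rightarrow> ('a \<Rightarrow> real) \<Rightarrow> 'a \<Rightarrow> real" where
  "partial_deriv b w p = deriv (\<lambda>h. w (p + h *\<^sub>R b)) 0"

(* The last direction in the list is differentiated first. *)
primrec iter_partial :: "'a::euclidean_space list \<Rightarrow> ('a \<Rightarrow> real) \<Rightarrow> 'a \<Rightarrow> real" where
  "iter_partial [] w = w"
| "iter_partial (b # bs) w = partial_deriv b (iter_partial bs w)"

(* The class C^k(A), meant for sets A with A \<subseteq> closure (interior A). Derivatives are
   taken in interior A only and have to admit continuous continuations to A. The derivative
   of order 0 is w itself, which is already given on A: hence continuous_on A w. *)
definition Ck_on :: "nat \<Rightarrow> 'a::euclidean_space set \<Rightarrow> ('a \<Rightarrow> real) \<Rightarrow> bool" where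
  "Ck_on k A w \<longleftrightarrow>
     continuous_on A w \<and>
     (\<forall>bs b p. set bs \<subseteq> Basis \<and> length bs < k \<and> b \<in> Basis \<and> p \<in> interior A \<longrightarrow>
        (\<lambda>h. iter_partial bs w (p + h *\<^sub>R b)) field_differentiable (at 0)) \<and>
     (\<forall>bs. set bs \<subseteq> Basis \<and> length bs \<le> k \<longrightarrow>
        (\<exists>g. continuous_on A g \<and> (\<forall>p\<in>interior A. g p = iter_partial bs w p)))"

(* Value at p of the derivative of w in the directions bs; outside interior A this is the
   continuous continuation, i.e. the limit from within interior A. *)
definition deriv_on :: "'a::euclidean_space set \<Rightarrow> 'a list \<Rightarrow> ('a \<Rightarrow> real) \<Rightarrow> 'a \<Rightarrow> real" where
  "deriv_on A bs w p =
     (if p \<in> interior A then iter_partial bs w p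
      else Lim (at p within interior A) (iter_partial bs w))"

(* Points of the plane are (t, x). *)
definition half_strip :: "(real \<times> real) set" where
  "half_strip = {0..} \<times> {0..1}"

definition open_half_strip :: "(real \<times> real) set" where
  "open_half_strip = {0<..} \<times> {0<..<1}"

definition D_t :: "(real \<times> real \<Rightarrow> real) \<Rightarrow> real \<times> real \<Rightarrow> real" where
  "D_t w = deriv_on half_strip [(1, 0)] w"

definition D_x :: "(real \<times> real \<Rightarrow> real) \<Rightarrow> real \<times> real \<Rightarrow> real" where
  "D_x w = deriv_on half_strip [(0, 1)] w"

definition D_tt :: "(real \<times> real \<Rightarrow> real) \<Rightarrow> real \<times> real \<Rightarrow> real" where
  "D_tt w = iter_partial [(1, 0), (1, 0)] w"

definition D_xx :: "(real \<times> real \<Rightarrow> real) \<Rightarrow> real \<times> real \<Rightarrow> real" where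
  "D_xx w = iter_partial [(0, 1), (0, 1)] w"

definition profile :: "(real \<times> real \<Rightarrow> real) \<Rightarrow> real \<Rightarrow> real \<Rightarrow> real" where
  "profile w t = (\<lambda>x. w (t, x))"

definition in_L2 :: "(real \<Rightarrow> real) \<Rightarrow> bool" where
  "in_L2 v \<longleftrightarrow> v \<in> borel_measurable (lebesgue_on {0<..<1}) \<and>
     integrable (lebesgue_on {0<..<1}) (\<lambda>x. \<bar>v x\<bar>\<^sup>2)"

definition norm_L2 :: "(real \<Rightarrow> real) \<Rightarrow> real" where
  "norm_L2 v = sqrt (integral\<^sup>L (lebesgue_on {0<..<1}) (\<lambda>x. \<bar>v x\<bar>\<^sup>2))"

(* w \<in> C^0([0,\<infinity>); L^2(0,1)); the function profile w t represents its class in L^2(0,1). *)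
definition continuous_into_L2 :: "(real \<times> real \<Rightarrow> real) \<Rightarrow> bool" where
  "continuous_into_L2 w \<longleftrightarrow>
     (\<forall>t\<ge>0. in_L2 (profile w t)) \<and>
     (\<forall>t\<ge>0. ((\<lambda>s. norm_L2 (\<lambda>x. profile w s x - profile w t x)) \<longlongrightarrow> 0) (at t within {0..}))"

end

theory Submission
  imports Defs
begin

text \<open>
  The argument is a Lyapunov estimate with the classical multiplier \<open>x u\<^sub>x\<close>. Write \<open>p = u\<^sub>t\<close> and
  \<open>q = u\<^sub>x\<close>. Without inputs, the energy \<open>\<integral> p\<^sup>2 + c\<^sup>2 q\<^sup>2\<close> is lost only at the end \<open>x = 1\<close>, where the boundary feedback acts, and
  in the viscous term if \<open>\<mu> > 0\<close>; this alone does not bound its rate of decay. For small \<open>\<delta> > 0\<close> the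
  functional
    \<open>V (t) = \<integral>\<^sub>0\<^sup>1 p\<^sup>2 + c\<^sup>2 q\<^sup>2 + 2 \<delta> x p q\<close>
  is still equivalent to the energy, and its density satisfies
    \<open>\<Phi>\<^sub>t = (2 c\<^sup>2 p q + \<delta> x (p\<^sup>2 + c\<^sup>2 q\<^sup>2))\<^sub>x - \<delta> (p\<^sup>2 + c\<^sup>2 q\<^sup>2) - 2 \<mu> p\<^sup>2 - 2 \<delta> \<mu> x p q + 2 (p + \<delta> x q) f\<close>.
  The second term on the right is dissipation distributed over the whole interval; with the help of
  \<open>- 2 \<mu> p\<^sup>2\<close> it absorbs the damping of the cross term and, up to a multiple of \<open>f\<^sup>2\<close>, the forcing (\<open>energy_dissipation\<close>). The flux
  vanishes at \<open>x = 0\<close> since \<open>p = 0\<close> there, and at \<open>x = 1\<close> it is at most a multiple of \<open>d\<^sup>2\<close>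
  (\<open>boundary_flux_bound\<close>). Hence \<open>V\<close> decays exponentially up to squares of the suprema of the inputs
  (\<open>lyapunov_decay\<close>), and square roots give the theorem.

  The delicate point is regularity. The second derivatives of \<open>u\<close> and the forcing are continuous only
  inside the half strip and may be unbounded near its boundary, so that \<open>V\<close> need not be
  differentiable. The pointwise inequality is therefore integrated over rectangles
  \<open>[s, t] \<times> [y, 1 - y]\<close>, and the limits \<open>y \<rightarrow> 0\<close> and \<open>s \<rightarrow> 0\<close> are taken in the integrated form, which contains
  only the continuous functions \<open>p\<close> and \<open>q\<close> and the norm of \<open>f\<close> (\<open>half_strip_balance\<close>).
\<close>

section \<open>Classical derivatives on the half strip\<close>

lemma open_open_half_strip: "open open_half_strip"
  by (simp add: open_half_strip_def open_Times)

lemma interior_half_strip: "interior half_strip = open_half_strip"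
  by (simp add: half_strip_def open_half_strip_def interior_Times)

lemma closure_open_half_strip: "closure open_half_strip = half_strip"
  by (simp add: half_strip_def open_half_strip_def closure_Times)

lemma interior_open_half_strip: "interior open_half_strip = open_half_strip"
  by (simp add: open_open_half_strip interior_open)

lemma open_half_strip_subset: "open_half_strip \<subseteq> half_strip"
  by (auto simp: open_half_strip_def half_strip_def)

lemma has_real_derivative_partial_t:
  assumes "(\<lambda>h. w ((t, x) + h *\<^sub>R (1, 0))) field_differentiable (at 0)"
  shows "((\<lambda>\<sigma>. w (\<sigma>, x)) has_real_derivative partial_deriv (1, 0) w (t, x)) (at t)"
proof -
  have "((\<lambda>h. w ((t, x) + h *\<^sub>R (1, 0))) has_real_derivative partial_deriv (1, 0) w (t, x)) (at 0)"
    using assms by (simp only: partial_deriv_def DERIV_deriv_iff_field_differentiable)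
  then show ?thesis
    using DERIV_shift[of "\<lambda>\<sigma>. w (\<sigma>, x)" _ 0 t] by (simp add: add.commute)
qed

lemma has_real_derivative_partial_x:
  assumes "(\<lambda>h. w ((t, x) + h *\<^sub>R (0, 1))) field_differentiable (at 0)"
  shows "((\<lambda>y. w (t, y)) has_real_derivative partial_deriv (0, 1) w (t, x)) (at x)"
proof -
  have "((\<lambda>h. w ((t, x) + h *\<^sub>R (0, 1))) has_real_derivative partial_deriv (0, 1) w (t, x)) (at 0)"
    using assms by (simp only: partial_deriv_def DERIV_deriv_iff_field_differentiable)
  then show ?thesis
    using DERIV_shift[of "\<lambda>y. w (t, y)" _ 0 x] by (simp add: add.commute)
qed

text \<open>
  A continuous extension of a derivative is unique, so the limit taken in \<open>deriv_on\<close> exists and is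
  the value of whichever extension the regularity class provides.
\<close>
lemma deriv_on_eq_extension:
  assumes A: "A \<subseteq> closure (interior A)" and g: "continuous_on A g"
    and eq: "\<And>p. p \<in> interior A \<Longrightarrow> g p = iter_partial bs w p" and p: "p \<in> A"
  shows "deriv_on A bs w p = g p"
proof (cases "p \<in> interior A")
  case True
  then show ?thesis by (simp add: deriv_on_def eq)
next
  case False
  have "(g \<longlongrightarrow> g p) (at p within A)"
    using g p by (auto simp: continuous_on_def)
  then have "(g \<longlongrightarrow> g p) (at p within interior A)"
    by (rule tendsto_within_subset) (rule interior_subset)
  moreover have "\<forall>\<^sub>F z in at p within interior A. g z = iter_partial bs w z"
    using eq by (auto simp: eventually_at_filter)
  ultimately have "(iter_partial bs w \<longlongrightarrow> g p) (at p within interior A)"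
    using tendsto_cong by blast
  moreover have "at p within interior A \<noteq> bot"
    using A p False by (auto simp: closure_def trivial_limit_within)
  ultimately have "Lim (at p within interior A) (iter_partial bs w) = g p"
    by (intro tendsto_Lim) auto
  then show ?thesis
    using False by (simp add: deriv_on_def)
qed

lemma C1_half_strip_deriv_on:
  assumes u: "Ck_on 1 half_strip u" and b: "b \<in> Basis"
  shows "continuous_on half_strip (deriv_on half_strip [b] u)"
    and "\<And>z. z \<in> open_half_strip \<Longrightarrow> deriv_on half_strip [b] u z = partial_deriv b u z"
proof -
  have "set [b] \<subseteq> Basis" "length [b] \<le> 1" using b by auto
  with u obtain g where g: "continuous_on half_strip g"
      "\<And>z. z \<in> interior half_strip \<Longrightarrow> g z = iter_partial [b] u z"
    unfolding Ck_on_def by blast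
  have eq: "deriv_on half_strip [b] u z = g z" if "z \<in> half_strip" for z
    using g that by (intro deriv_on_eq_extension)
      (simp_all add: interior_half_strip closure_open_half_strip)
  show "continuous_on half_strip (deriv_on half_strip [b] u)"
    using g(1) eq by (simp cong: continuous_on_cong)
  show "deriv_on half_strip [b] u z = partial_deriv b u z" if "z \<in> open_half_strip" for z
    using that by (simp add: deriv_on_def interior_half_strip)
qed

text \<open>
  Schwarz's theorem in the form that iterated partial derivatives require: all derivatives are along
  coordinate lines. Applying the mean value theorem twice, in either order, to the second difference
  over a small square gives two nearby points at which the two mixed derivatives coincide.
\<close>
lemma mixed_partials_eq:
  fixes w wt wx wtx wxt :: "real \<times> real \<Rightarrow> real"
  assumes S: "open S" and z: "z \<in> S"
    and dt: "\<And>\<tau> y. (\<tau>, y) \<in> S \<Longrightarrow> ((\<lambda>\<sigma>. w (\<sigma>, y)) has_real_derivative wt (\<tau>, y)) (at \<tau>)"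
    and dx: "\<And>\<tau> y. (\<tau>, y) \<in> S \<Longrightarrow> ((\<lambda>\<xi>. w (\<tau>, \<xi>)) has_real_derivative wx (\<tau>, y)) (at y)"
    and dtx: "\<And>\<tau> y. (\<tau>, y) \<in> S \<Longrightarrow> ((\<lambda>\<xi>. wt (\<tau>, \<xi>)) has_real_derivative wtx (\<tau>, y)) (at y)"
    and dxt: "\<And>\<tau> y. (\<tau>, y) \<in> S \<Longrightarrow> ((\<lambda>\<sigma>. wx (\<sigma>, y)) has_real_derivative wxt (\<tau>, y)) (at \<tau>)"
    and ctx: "continuous_on S wtx" and cxt: "continuous_on S wxt"
  shows "wtx z = wxt z"
proof -
  obtain t x where zt: "z = (t, x)" by (cases z)
  have approx: "\<bar>wtx z - wxt z\<bar> \<le> 2 * e" if e: "e > 0" for e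
  proof -
    have "isCont wtx z" "isCont wxt z"
      using ctx cxt S z by (auto simp: continuous_on_eq_continuous_at)
    then obtain d1 d2 where d: "d1 > 0" "d2 > 0"
      and d1: "\<And>v. dist v z < d1 \<Longrightarrow> dist (wtx v) (wtx z) < e"
      and d2: "\<And>v. dist v z < d2 \<Longrightarrow> dist (wxt v) (wxt z) < e"
      using e unfolding continuous_at_eps_delta by metis
    obtain d3 where d3: "d3 > 0" "ball z d3 \<subseteq> S"
      using S z open_contains_ball by blast
    define h where "h = min d1 (min d2 d3) / 4"
    have h: "h > 0" using d d3 by (simp add: h_def)
    have near: "dist (\<tau>, y) z < d1 \<and> dist (\<tau>, y) z < d2 \<and> (\<tau>, y) \<in> S"
      if "\<tau> \<in> {t..t + h}" "y \<in> {x..x + h}" for \<tau> y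
    proof -
      have "dist (\<tau>, y) (t, x) \<le> dist \<tau> t + dist y x"
        unfolding dist_Pair_Pair by (rule sqrt_sum_squares_le_sum) auto
      also have "\<dots> \<le> 2 * h" using that by (auto simp: dist_real_def)
      also have "\<dots> < min d1 (min d2 d3)" using h unfolding h_def by linarith
      finally have "dist (\<tau>, y) z < min d1 (min d2 d3)" by (simp add: zt)
      then show ?thesis
        using d3(2) by (auto simp: dist_commute subset_iff)
    qed
    \<comment> \<open>Both mixed derivatives, at suitable points of the square, are the second difference
      of \<open>w\<close> over the square divided by its area.\<close>
    define \<Delta> where "\<Delta> = w (t + h, x + h) - w (t + h, x) - w (t, x + h) + w (t, x)"
    have "\<exists>\<tau>>t. \<tau> < t + h \<and> (w (t + h, x + h) - w (t + h, x)) - (w (t, x + h) - w (t, x))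
            = (t + h - t) * (wt (\<tau>, x + h) - wt (\<tau>, x))"
      using h near by (intro MVT2[of t "t + h" "\<lambda>\<tau>. w (\<tau>, x + h) - w (\<tau>, x)"])
        (auto intro!: derivative_intros dt)
    then obtain \<tau> where \<tau>: "t < \<tau>" "\<tau> < t + h" "\<Delta> = h * (wt (\<tau>, x + h) - wt (\<tau>, x))"
      by (auto simp: \<Delta>_def algebra_simps)
    have "\<exists>y>x. y < x + h \<and> wt (\<tau>, x + h) - wt (\<tau>, x) = (x + h - x) * wtx (\<tau>, y)"
      using h near \<tau> by (intro MVT2[of x "x + h" "\<lambda>y. wt (\<tau>, y)"]) (auto intro!: dtx)
    then obtain y where y: "x < y" "y < x + h" "wt (\<tau>, x + h) - wt (\<tau>, x) = h * wtx (\<tau>, y)"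
      by auto
    have "\<exists>y>x. y < x + h \<and> (w (t + h, x + h) - w (t, x + h)) - (w (t + h, x) - w (t, x))
            = (x + h - x) * (wx (t + h, y) - wx (t, y))"
      using h near by (intro MVT2[of x "x + h" "\<lambda>y. w (t + h, y) - w (t, y)"])
        (auto intro!: derivative_intros dx)
    then obtain y' where y': "x < y'" "y' < x + h" "\<Delta> = h * (wx (t + h, y') - wx (t, y'))"
      by (auto simp: \<Delta>_def algebra_simps)
    have "\<exists>\<tau>>t. \<tau> < t + h \<and> wx (t + h, y') - wx (t, y') = (t + h - t) * wxt (\<tau>, y')"
      using h near y' by (intro MVT2[of t "t + h" "\<lambda>\<tau>. wx (\<tau>, y')"]) (auto intro!: dxt)
    then obtain \<tau>' where \<tau>': "t < \<tau>'" "\<tau>' < t + h" "wx (t + h, y') - wx (t, y') = h * wxt (\<tau>', y')"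
      by auto
    have "wtx (\<tau>, y) = wxt (\<tau>', y')"
      using \<tau>(3) y(3) y'(3) \<tau>'(3) h by auto
    moreover have "dist (wtx (\<tau>, y)) (wtx z) < e"
      using near[of \<tau> y] \<tau> y by (intro d1) auto
    moreover have "dist (wxt (\<tau>', y')) (wxt z) < e"
      using near[of \<tau>' y'] y' \<tau>' by (intro d2) auto
    ultimately show ?thesis
      by (auto simp: dist_real_def)
  qed
  have "\<bar>wtx z - wxt z\<bar> \<le> 0 + e" if "e > 0" for e
    using approx[of "e / 2"] that by simp
  then have "\<bar>wtx z - wxt z\<bar> \<le> 0" by (rule field_le_epsilon)
  then show ?thesis by simp
qed

text \<open>
  The value of \<open>u\<^sub>t\<close> on the boundary is a limit from inside and not a derivative of
  \<open>u\<close> along the boundary, so \<open>u (t, 0) = 0\<close> has to be related to it: the fundamental theorem of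
  calculus in \<open>t\<close> passes to the limit \<open>x \<rightarrow> 0\<close>.
\<close>
lemma time_deriv_zero_on_boundary:
  fixes u p :: "real \<times> real \<Rightarrow> real"
  assumes contu: "continuous_on half_strip u" and contp: "continuous_on half_strip p"
    and du: "\<And>t x. (t, x) \<in> open_half_strip \<Longrightarrow> ((\<lambda>\<sigma>. u (\<sigma>, x)) has_real_derivative p (t, x)) (at t)"
    and u0: "\<And>t. t > 0 \<Longrightarrow> u (t, 0) = 0" and t: "t > 0"
  shows "p (t, 0) = 0"
proof -
  \<comment> \<open>\<open>F y\<close> is the defect in the fundamental theorem of calculus on the line \<open>x = y\<close>; it vanishes
    inside, hence also at \<open>y = 0\<close>, where the increment of \<open>u\<close> is zero.\<close>
  have zero: "integral {t/2..s} (\<lambda>\<tau>. p (\<tau>, 0)) = 0" if s: "t / 2 \<le> s" for s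
  proof -
    define F where "F y = integral {t/2..s} (\<lambda>\<tau>. p (\<tau>, y)) - (u (s, y) - u (t/2, y))" for y
    have "continuous_on {0..1} (\<lambda>y. integral (cbox (t/2) s) (\<lambda>\<tau>. p (\<tau>, y)))"
      using t by (intro integral_continuous_on_param)
        (auto simp: split_beta half_strip_def intro!: continuous_intros continuous_on_compose2[OF contp])
    then have "continuous_on {0..1} F"
      unfolding F_def using s t
      by (intro continuous_intros continuous_on_compose2[OF contu]) (auto simp: half_strip_def)
    then have contF: "continuous_on (closure {0<..<1}) F"
      by simp
    have "F y = 0" if "y \<in> {0<..<1}" for y
    proof -
      have "((\<lambda>\<tau>. p (\<tau>, y)) has_integral u (s, y) - u (t/2, y)) {t/2..s}"
        using that t s
        by (intro fundamental_theorem_of_calculus)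
           (auto simp: open_half_strip_def simp flip: has_real_derivative_iff_has_vector_derivative
             intro!: has_field_derivative_at_within du)
      then show ?thesis by (simp add: F_def integral_unique)
    qed
    then have "F 0 = 0"
      using continuous_constant_on_closure[OF contF, of 0 0] by auto
    then show ?thesis
      using u0[of s] u0[of "t/2"] s t by (simp add: F_def)
  qed
  have "((\<lambda>s. integral {t/2..s} (\<lambda>\<tau>. p (\<tau>, 0))) has_real_derivative p (t, 0)) (at t within {t/2..2*t})"
    using t by (intro integral_has_real_derivative continuous_on_compose2[OF contp])
      (auto simp: half_strip_def intro!: continuous_intros)
  then have "((\<lambda>s. integral {t/2..s} (\<lambda>\<tau>. p (\<tau>, 0))) has_real_derivative p (t, 0)) (at t)"
    using t by (simp add: at_within_Icc_at)
  then have "((\<lambda>s. 0) has_real_derivative p (t, 0)) (at t)"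
    by (rule has_field_derivative_transform_within_open[where S = "{t/2<..}"])
       (use t zero in auto)
  then show ?thesis
    using DERIV_const DERIV_unique by blast
qed

section \<open>Integrated balance laws\<close>

text \<open>
  A differential inequality \<open>P\<^sub>t \<le> Q\<^sub>x + g\<close> integrates over a rectangle by the fundamental theorem
  of calculus in each variable and Fubini's theorem. The source is controlled only through a bound \<open>m\<close>
  of its integrals in \<open>x\<close>, because this is what the norm of a forcing term provides.
\<close>
lemma rectangle_balance:
  fixes P Q A B g :: "real \<times> real \<Rightarrow> real" and m :: "real \<Rightarrow> real"
  assumes st: "s \<le> t" and lr: "l \<le> r"
    and contP: "continuous_on ({s..t} \<times> {l..r}) P" and contQ: "continuous_on ({s..t} \<times> {l..r}) Q"
    and contA: "continuous_on ({s..t} \<times> {l..r}) A" and contB: "continuous_on ({s..t} \<times> {l..r}) B"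
    and contg: "continuous_on ({s..t} \<times> {l..r}) g" and contm: "continuous_on {s..t} m"
    and dP: "\<And>\<tau> x. \<tau> \<in> {s..t} \<Longrightarrow> x \<in> {l..r} \<Longrightarrow>
               ((\<lambda>\<sigma>. P (\<sigma>, x)) has_real_derivative A (\<tau>, x)) (at \<tau>)"
    and dQ: "\<And>\<tau> x. \<tau> \<in> {s..t} \<Longrightarrow> x \<in> {l..r} \<Longrightarrow>
               ((\<lambda>y. Q (\<tau>, y)) has_real_derivative B (\<tau>, x)) (at x)"
    and AB: "\<And>z. z \<in> {s..t} \<times> {l..r} \<Longrightarrow> A z \<le> B z + g z"
    and gm: "\<And>\<tau>. \<tau> \<in> {s..t} \<Longrightarrow> integral {l..r} (\<lambda>x. g (\<tau>, x)) \<le> m \<tau>"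
  shows "integral {l..r} (\<lambda>x. P (t, x)) - integral {l..r} (\<lambda>x. P (s, x))
           \<le> integral {s..t} (\<lambda>\<tau>. Q (\<tau>, r) - Q (\<tau>, l) + m \<tau>)"
proof -
  have row: "continuous_on {l..r} (\<lambda>x. h (\<tau>, x))"
    if "continuous_on ({s..t} \<times> {l..r}) h" "\<tau> \<in> {s..t}" for h :: "real \<times> real \<Rightarrow> real" and \<tau>
    by (rule continuous_on_compose2[OF that(1)]) (use that(2) in \<open>auto intro!: continuous_intros\<close>)
  have col: "continuous_on {s..t} (\<lambda>\<tau>. h (\<tau>, x))"
    if "continuous_on ({s..t} \<times> {l..r}) h" "x \<in> {l..r}" for h :: "real \<times> real \<Rightarrow> real" and x
    by (rule continuous_on_compose2[OF that(1)]) (use that(2) in \<open>auto intro!: continuous_intros\<close>)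
  have "integral {l..r} (\<lambda>x. P (t, x)) - integral {l..r} (\<lambda>x. P (s, x))
      = integral {l..r} (\<lambda>x. P (t, x) - P (s, x))"
    using row[OF contP] st by (intro integral_diff[symmetric] integrable_continuous_real) auto
  also have "\<dots> = integral {l..r} (\<lambda>x. integral {s..t} (\<lambda>\<tau>. A (\<tau>, x)))"
  proof (rule integral_cong)
    fix x assume x: "x \<in> {l..r}"
    have "((\<lambda>\<tau>. A (\<tau>, x)) has_integral P (t, x) - P (s, x)) {s..t}"
      using dP x by (intro fundamental_theorem_of_calculus st)
        (auto simp: has_real_derivative_iff_has_vector_derivative[symmetric]
          intro: has_field_derivative_at_within)
    then show "P (t, x) - P (s, x) = integral {s..t} (\<lambda>\<tau>. A (\<tau>, x))"
      by (simp add: integral_unique)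
  qed
  also have "\<dots> = integral {s..t} (\<lambda>\<tau>. integral {l..r} (\<lambda>x. A (\<tau>, x)))"
    using integral_swap_continuous[of s l t r "\<lambda>\<tau> x. A (\<tau>, x)"] contA
    by (simp add: cbox_Pair_eq)
  also have "\<dots> \<le> integral {s..t} (\<lambda>\<tau>. Q (\<tau>, r) - Q (\<tau>, l) + m \<tau>)"
  proof (rule integral_le)
    have "continuous_on {s..t} (\<lambda>\<tau>. integral (cbox l r) (\<lambda>x. A (\<tau>, x)))"
      using contA by (intro integral_continuous_on_param) simp
    then show "(\<lambda>\<tau>. integral {l..r} (\<lambda>x. A (\<tau>, x))) integrable_on {s..t}"
      by (intro integrable_continuous_real) simp
    show "(\<lambda>\<tau>. Q (\<tau>, r) - Q (\<tau>, l) + m \<tau>) integrable_on {s..t}"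
      using lr by (intro integrable_continuous_real continuous_intros contm col[OF contQ]) auto
  next
    fix \<tau> assume \<tau>: "\<tau> \<in> {s..t}"
    have "((\<lambda>x. B (\<tau>, x)) has_integral Q (\<tau>, r) - Q (\<tau>, l)) {l..r}"
      using dQ \<tau> by (intro fundamental_theorem_of_calculus lr)
        (auto simp: has_real_derivative_iff_has_vector_derivative[symmetric]
          intro: has_field_derivative_at_within)
    then have "integral {l..r} (\<lambda>x. B (\<tau>, x) + g (\<tau>, x))
        = Q (\<tau>, r) - Q (\<tau>, l) + integral {l..r} (\<lambda>x. g (\<tau>, x))"
      using row[OF contg \<tau>] by (subst integral_add)
        (auto intro: integrable_continuous_real simp: integral_unique)
    moreover have "integral {l..r} (\<lambda>x. A (\<tau>, x)) \<le> integral {l..r} (\<lambda>x. B (\<tau>, x) + g (\<tau>, x))"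
      using AB \<tau> by (intro integral_le integrable_continuous_real continuous_intros row
          contA contB contg) auto
    ultimately show "integral {l..r} (\<lambda>x. A (\<tau>, x)) \<le> Q (\<tau>, r) - Q (\<tau>, l) + m \<tau>"
      using gm[OF \<tau>] by linarith
  qed
  finally show ?thesis .
qed

text \<open>
  The rectangle may be pushed to the lateral boundary although the derivatives and the source may be
  unbounded there: the two sides of the balance involve \<open>P\<close>, \<open>Q\<close> and \<open>m\<close> only.
\<close>
lemma half_strip_balance:
  fixes P Q A B g :: "real \<times> real \<Rightarrow> real" and m :: "real \<Rightarrow> real"
  assumes s: "0 < s" and st: "s \<le> t"
    and contP: "continuous_on half_strip P" and contQ: "continuous_on half_strip Q"
    and contA: "continuous_on open_half_strip A" and contB: "continuous_on open_half_strip B"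
    and contg: "continuous_on open_half_strip g" and contm: "continuous_on {s..t} m"
    and dP: "\<And>\<tau> x. (\<tau>, x) \<in> open_half_strip \<Longrightarrow>
               ((\<lambda>\<sigma>. P (\<sigma>, x)) has_real_derivative A (\<tau>, x)) (at \<tau>)"
    and dQ: "\<And>\<tau> x. (\<tau>, x) \<in> open_half_strip \<Longrightarrow>
               ((\<lambda>y. Q (\<tau>, y)) has_real_derivative B (\<tau>, x)) (at x)"
    and AB: "\<And>z. z \<in> open_half_strip \<Longrightarrow> A z \<le> B z + g z"
    and gm: "\<And>\<tau> l r. \<tau> \<in> {s..t} \<Longrightarrow> 0 < l \<Longrightarrow> l \<le> r \<Longrightarrow> r < 1 \<Longrightarrow>
               integral {l..r} (\<lambda>x. g (\<tau>, x)) \<le> m \<tau>"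
  shows "integral {0..1} (\<lambda>x. P (t, x)) - integral {0..1} (\<lambda>x. P (s, x))
           \<le> integral {s..t} (\<lambda>\<tau>. Q (\<tau>, 1) - Q (\<tau>, 0) + m \<tau>)"
proof -
  define I where "I \<tau> y = integral {0..y} (\<lambda>x. P (\<tau>, x))" for \<tau> y
  define R where "R y = integral {s..t} (\<lambda>\<tau>. Q (\<tau>, 1 - y) - Q (\<tau>, y) + m \<tau>)" for y
  define D where "D y = I t (1 - y) - I t y - (I s (1 - y) - I s y) - R y" for y
  have rowP: "continuous_on {0..1} (\<lambda>x. P (\<tau>, x))" if "\<tau> \<ge> 0" for \<tau>
    by (rule continuous_on_compose2[OF contP])
       (use that in \<open>auto intro!: continuous_intros simp: half_strip_def\<close>)
  have contI: "continuous_on {0..1} (I \<tau>)" if "\<tau> \<ge> 0" for \<tau>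
    unfolding I_def
    by (intro indefinite_integral_continuous_1 integrable_continuous_real rowP that)
  have "continuous_on {0..1/2} (\<lambda>y. integral (cbox s t) (\<lambda>\<tau>. Q (\<tau>, 1 - y) - Q (\<tau>, y) + m \<tau>))"
    using s by (intro integral_continuous_on_param)
       (auto simp: split_beta half_strip_def intro!: continuous_intros continuous_on_compose2[OF contQ]
           continuous_on_compose2[OF contm])
  then have contR: "continuous_on {0..1/2} R"
    by (simp add: R_def[abs_def])
  have "continuous_on {0..1/2} D"
    unfolding D_def using s st
    by (intro continuous_intros contR continuous_on_compose2[OF contI, of _ "{0..1/2}" "\<lambda>y. 1 - y"]
        continuous_on_subset[OF contI]) auto
  then have contD: "continuous_on (closure {0<..<1/2}) D"
    by simp
  \<comment> \<open>The defect \<open>D y\<close> is the claim for the interval \<open>[y, 1 - y]\<close>. Writing its left-hand side with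
    the antiderivative \<open>I\<close> makes the continuity of \<open>D\<close> at \<open>y = 0\<close> visible.\<close>
  have D_le: "D y \<le> 0" if "y \<in> {0<..<1/2}" for y
  proof -
    have y: "0 < y" "y < 1 - y" "1 - y < 1" "y < 1" using that by auto
    have sub: "{s..t} \<times> {y..1 - y} \<subseteq> open_half_strip" "{s..t} \<times> {y..1 - y} \<subseteq> half_strip"
      using s y by (auto simp: open_half_strip_def half_strip_def)
    have "integral {y..1 - y} (\<lambda>x. P (t, x)) - integral {y..1 - y} (\<lambda>x. P (s, x)) \<le> R y"
      unfolding R_def
      by (rule rectangle_balance[where A = A and B = B and g = g])
         (use sub s st y in \<open>auto intro!: contm dP dQ AB gm continuous_on_subset[OF contP]
            continuous_on_subset[OF contQ] continuous_on_subset[OF contA]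
            continuous_on_subset[OF contB] continuous_on_subset[OF contg]\<close>)
    moreover have "integral {y..1 - y} (\<lambda>x. P (\<tau>, x)) = I \<tau> (1 - y) - I \<tau> y" if "\<tau> \<ge> 0" for \<tau>
    proof -
      have "(\<lambda>x. P (\<tau>, x)) integrable_on {0..1 - y}"
        using rowP[OF that] y by (intro integrable_continuous_real) (auto elim: continuous_on_subset)
      then have "integral {0..y} (\<lambda>x. P (\<tau>, x)) + integral {y..1 - y} (\<lambda>x. P (\<tau>, x))
          = integral {0..1 - y} (\<lambda>x. P (\<tau>, x))"
        using y by (intro Henstock_Kurzweil_Integration.integral_combine) auto
      then show ?thesis by (simp add: I_def)
    qed
    ultimately show ?thesis
      using s st by (simp add: D_def)
  qed
  have "D 0 \<le> 0"
    by (rule continuous_le_on_closure[OF contD]) (use D_le in auto)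
  then show ?thesis
    by (simp add: D_def I_def R_def)
qed

section \<open>Pointwise energy estimates\<close>

text \<open>
  Since \<open>2 c \<bar>p q\<bar> \<le> p\<^sup>2 + c\<^sup>2 q\<^sup>2\<close>, the cross term cannot spoil the positivity of the Lyapunov density.
\<close>
lemma cross_term_bound:
  fixes c \<delta> x p q :: real
  assumes c: "c > 0" and \<delta>: "0 < \<delta>" "\<delta> \<le> c / 2" and x: "0 \<le> x" "x \<le> 1"
  shows "\<bar>2 * \<delta> * x * p * q\<bar> \<le> (p\<^sup>2 + c\<^sup>2 * q\<^sup>2) / 2"
proof -
  have "\<bar>2 * \<delta> * x * p * q\<bar> = 2 * (\<delta> * x) * (\<bar>p\<bar> * \<bar>q\<bar>)"
    using \<delta> x by (simp add: abs_mult)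
  also have "\<dots> \<le> 2 * (c / 2) * (\<bar>p\<bar> * \<bar>q\<bar>)"
    using \<delta> x mult_mono[of \<delta> "c/2" x 1] by (intro mult_right_mono) auto
  also have "\<dots> \<le> (p\<^sup>2 + c\<^sup>2 * q\<^sup>2) / 2"
    using zero_le_power2[of "\<bar>p\<bar> - c * \<bar>q\<bar>"] by (simp add: power2_diff power_mult_distrib mult_ac)
  finally show ?thesis .
qed

text \<open>
  The Lyapunov functional is thereby equivalent to the squared norm that the theorem is about.
\<close>
lemma lyapunov_density_equivalent:
  fixes c \<delta> x p q :: real
  assumes c: "c > 0" and \<delta>: "0 < \<delta>" "\<delta> \<le> c / 2" and x: "0 \<le> x" "x \<le> 1"
  shows "min 1 (c\<^sup>2) / 2 * (p\<^sup>2 + q\<^sup>2) \<le> p\<^sup>2 + c\<^sup>2 * q\<^sup>2 + 2 * \<delta> * x * p * q"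
    and "p\<^sup>2 + c\<^sup>2 * q\<^sup>2 + 2 * \<delta> * x * p * q \<le> 3 / 2 * max 1 (c\<^sup>2) * (p\<^sup>2 + q\<^sup>2)"
proof -
  have "\<bar>2 * \<delta> * x * p * q\<bar> \<le> (p\<^sup>2 + c\<^sup>2 * q\<^sup>2) / 2"
    by (rule cross_term_bound[OF c \<delta> x])
  moreover have "min 1 (c\<^sup>2) * p\<^sup>2 \<le> 1 * p\<^sup>2" "min 1 (c\<^sup>2) * q\<^sup>2 \<le> c\<^sup>2 * q\<^sup>2"
    "1 * p\<^sup>2 \<le> max 1 (c\<^sup>2) * p\<^sup>2" "c\<^sup>2 * q\<^sup>2 \<le> max 1 (c\<^sup>2) * q\<^sup>2"
    by (intro mult_right_mono; simp)+
  ultimately show "min 1 (c\<^sup>2) / 2 * (p\<^sup>2 + q\<^sup>2) \<le> p\<^sup>2 + c\<^sup>2 * q\<^sup>2 + 2 * \<delta> * x * p * q"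
    and "p\<^sup>2 + c\<^sup>2 * q\<^sup>2 + 2 * \<delta> * x * p * q \<le> 3 / 2 * max 1 (c\<^sup>2) * (p\<^sup>2 + q\<^sup>2)"
    by (auto simp: field_simps abs_le_iff)
qed

text \<open>
  For a solution with \<open>p = u\<^sub>t\<close> and \<open>q = u\<^sub>x\<close>, the left-hand side is the source that remains when the flux
  derivative is subtracted from the time derivative of the Lyapunov density, increased by \<open>\<delta> / 6\<close>
  times the density itself. The term \<open>- \<delta> (p\<^sup>2 + c\<^sup>2 q\<^sup>2)\<close>, which the multiplier \<open>x u\<^sub>x\<close> creates, dominates
  the rest together with \<open>- 2 \<mu> p\<^sup>2\<close>, up to a multiple of \<open>f\<^sup>2\<close>.
\<close>
lemma energy_dissipation:
  fixes c \<mu> \<delta> x p q f :: real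
  assumes c: "c > 0" and \<mu>: "\<mu> \<ge> 0" and \<delta>: "0 < \<delta>" "\<delta> \<le> c / 2" "\<delta> * \<mu> \<le> c\<^sup>2"
    and x: "0 \<le> x" "x \<le> 1"
  shows "\<delta> / 6 * (p\<^sup>2 + c\<^sup>2 * q\<^sup>2 + 2 * \<delta> * x * p * q)
           - \<delta> * (p\<^sup>2 + c\<^sup>2 * q\<^sup>2) - 2 * \<mu> * p\<^sup>2 - 2 * \<delta> * \<mu> * x * p * q + 2 * (p + \<delta> * x * q) * f
         \<le> (8 / \<delta> + 8 * \<delta> / c\<^sup>2) * f\<^sup>2"
proof -
  let ?e = "p\<^sup>2 + c\<^sup>2 * q\<^sup>2"
  have x2: "x\<^sup>2 \<le> 1" using x by (simp add: power_le_one)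
  have "\<delta> / 6 * (?e + 2 * \<delta> * x * p * q) \<le> \<delta> / 6 * (?e + ?e / 2)"
    using cross_term_bound[OF c \<delta>(1,2) x, of p q] \<delta> by (intro mult_left_mono) auto
  then have 1: "\<delta> / 6 * (?e + 2 * \<delta> * x * p * q) \<le> \<delta> / 4 * ?e"
    by (simp add: field_simps)
  \<comment> \<open>The damping of the cross term is absorbed by \<open>- 2 \<mu> p\<^sup>2\<close> and half of \<open>- \<delta> c\<^sup>2 q\<^sup>2\<close>; Young's
    inequality below gives the forcing an eighth of each of \<open>\<delta> p\<^sup>2\<close> and \<open>\<delta> c\<^sup>2 q\<^sup>2\<close>.\<close>
  have "- (2 * \<delta> * x * p * q) \<le> 2 * p\<^sup>2 + \<delta>\<^sup>2 * q\<^sup>2 * x\<^sup>2 / 2"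
    using zero_le_power2[of "2 * p + \<delta> * x * q"] by (simp add: power2_sum power_mult_distrib field_simps)
  also have "\<dots> \<le> 2 * p\<^sup>2 + \<delta>\<^sup>2 * q\<^sup>2 / 2"
    using mult_left_mono[OF x2, of "\<delta>\<^sup>2 * q\<^sup>2"] by simp
  finally have "\<mu> * - (2 * \<delta> * x * p * q) \<le> \<mu> * (2 * p\<^sup>2 + \<delta>\<^sup>2 * q\<^sup>2 / 2)"
    using \<mu> by (rule mult_left_mono)
  moreover have "\<mu> * (\<delta>\<^sup>2 * q\<^sup>2 / 2) \<le> \<delta> / 2 * (c\<^sup>2 * q\<^sup>2)"
    using mult_right_mono[OF \<delta>(3), of "\<delta> * q\<^sup>2 / 2"] \<delta>(1) by (simp add: power2_eq_square mult_ac)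
  ultimately have 2: "- 2 * \<mu> * p\<^sup>2 - 2 * \<delta> * \<mu> * x * p * q \<le> \<delta> / 2 * (c\<^sup>2 * q\<^sup>2)"
    by (simp add: algebra_simps)
  have 3: "2 * p * f \<le> \<delta> / 8 * p\<^sup>2 + 8 / \<delta> * f\<^sup>2"
    using zero_le_power2[of "\<delta> * p - 8 * f"] \<delta>(1)
    by (simp add: power2_diff power_mult_distrib field_simps power2_eq_square)
  have 4: "2 * (\<delta> * x * q) * f \<le> \<delta> / 8 * (c\<^sup>2 * q\<^sup>2) + 8 * \<delta> / c\<^sup>2 * f\<^sup>2"
  proof -
    have "2 * (x * q) * f \<le> c\<^sup>2 / 8 * (x * q)\<^sup>2 + 8 / c\<^sup>2 * f\<^sup>2"
      using zero_le_power2[of "c\<^sup>2 * (x * q) - 8 * f"] c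
      by (simp add: power2_diff power_mult_distrib field_simps power2_eq_square)
    also have "\<dots> \<le> c\<^sup>2 / 8 * q\<^sup>2 + 8 / c\<^sup>2 * f\<^sup>2"
      using mult_left_mono[OF x2, of "c\<^sup>2 * q\<^sup>2"] by (simp add: power_mult_distrib mult_ac)
    finally have "\<delta> * (2 * (x * q) * f) \<le> \<delta> * (c\<^sup>2 / 8 * q\<^sup>2 + 8 / c\<^sup>2 * f\<^sup>2)"
      using \<delta> by (intro mult_left_mono) auto
    then show ?thesis by (simp add: algebra_simps)
  qed
  have 5: "\<delta> * p\<^sup>2 \<ge> 0" "\<delta> * (c\<^sup>2 * q\<^sup>2) \<ge> 0" using \<delta> by auto
  show ?thesis
    using 1 2 3 4 5 by (simp add: algebra_simps)
qed

text \<open>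
  At \<open>x = 1\<close> the feedback turns the energy flux into \<open>- 2 a c\<^sup>2 p\<^sup>2 + 2 c\<^sup>2 p d\<close>. One half of the loss pays for
  the disturbance, the other half for the flux of the cross term.
\<close>
lemma boundary_flux_bound:
  fixes a c \<delta> p q d :: real
  assumes a: "a > 0" and c: "c > 0" and \<delta>: "0 < \<delta>" "\<delta> * (2 * c\<^sup>2 * a\<^sup>2 + 1) \<le> a * c\<^sup>2"
    and q: "q = - a * p + d"
  shows "2 * c\<^sup>2 * p * q + \<delta> * (p\<^sup>2 + c\<^sup>2 * q\<^sup>2) \<le> (c\<^sup>2 / a + 2 * \<delta> * c\<^sup>2) * d\<^sup>2"
proof -
  have "2 * p * d \<le> a * p\<^sup>2 + d\<^sup>2 / a"
    using zero_le_power2[of "a * p - d"] a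
    by (simp add: power2_diff power_mult_distrib field_simps power2_eq_square)
  then have "c\<^sup>2 * (2 * p * d) \<le> c\<^sup>2 * (a * p\<^sup>2 + d\<^sup>2 / a)"
    by (intro mult_left_mono) auto
  then have 1: "2 * c\<^sup>2 * p * q \<le> - (a * c\<^sup>2 * p\<^sup>2) + c\<^sup>2 / a * d\<^sup>2"
    by (simp add: q algebra_simps power2_eq_square)
  have "q\<^sup>2 \<le> 2 * a\<^sup>2 * p\<^sup>2 + 2 * d\<^sup>2"
    using zero_le_power2[of "a * p + d"] by (simp add: q power2_sum power_mult_distrib algebra_simps power2_eq_square)
  then have "\<delta> * (p\<^sup>2 + c\<^sup>2 * q\<^sup>2) \<le> \<delta> * (p\<^sup>2 + c\<^sup>2 * (2 * a\<^sup>2 * p\<^sup>2 + 2 * d\<^sup>2))"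
    using \<delta> by (intro mult_left_mono add_left_mono) auto
  also have "\<dots> = \<delta> * (2 * c\<^sup>2 * a\<^sup>2 + 1) * p\<^sup>2 + 2 * \<delta> * c\<^sup>2 * d\<^sup>2"
    by (simp add: algebra_simps)
  also have "\<dots> \<le> a * c\<^sup>2 * p\<^sup>2 + 2 * \<delta> * c\<^sup>2 * d\<^sup>2"
    using mult_right_mono[OF \<delta>(2), of "p\<^sup>2"] by simp
  finally show ?thesis
    using 1 by (simp add: algebra_simps)
qed

section \<open>Square-integrable profiles\<close>

lemma norm_L2_nonneg: "norm_L2 v \<ge> 0"
  by (simp add: norm_L2_def)

lemma norm_L2_square: "(norm_L2 v)\<^sup>2 = integral\<^sup>L (lebesgue_on {0<..<1}) (\<lambda>x. (v x)\<^sup>2)"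
  by (simp add: norm_L2_def)

lemma norm_L2_continuous:
  assumes "continuous_on {0..1} v"
  shows "(norm_L2 v)\<^sup>2 = integral {0..1} (\<lambda>x. (v x)\<^sup>2)"
proof -
  have "(\<lambda>x. (v x)\<^sup>2) absolutely_integrable_on {0..1}"
    using assms by (intro absolutely_integrable_continuous_real continuous_intros)
  then have "set_integrable lebesgue {0<..<1} (\<lambda>x. (v x)\<^sup>2)"
    by (rule set_integrable_subset) auto
  then have "integrable (lebesgue_on {0<..<1}) (\<lambda>x. (v x)\<^sup>2)"
    by (simp add: integrable_restrict_space set_integrable_def)
  then show ?thesis
    by (simp add: norm_L2_square lebesgue_integral_eq_integral integral_open_interval_real)
qed

lemma integral_square_le_norm_L2:
  assumes v: "in_L2 v" and lr: "0 < l" "r < 1"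
  shows "integral {l..r} (\<lambda>x. (v x)\<^sup>2) \<le> (norm_L2 v)\<^sup>2"
proof -
  have int: "integrable (lebesgue_on {0<..<1}) (\<lambda>x. (v x)\<^sup>2)"
    using v by (simp add: in_L2_def)
  then have set: "set_integrable lebesgue {0<..<1} (\<lambda>x. (v x)\<^sup>2)"
    by (simp add: integrable_restrict_space set_integrable_def)
  then have "set_integrable lebesgue {l..r} (\<lambda>x. (v x)\<^sup>2)"
    by (rule set_integrable_subset) (use lr in auto)
  then have "integral {l..r} (\<lambda>x. (v x)\<^sup>2) \<le> integral {0<..<1} (\<lambda>x. (v x)\<^sup>2)"
    using set lr by (intro integral_subset_le set_lebesgue_integral_eq_integral) auto
  then show ?thesis
    using int by (simp add: norm_L2_square lebesgue_integral_eq_integral)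
qed

text \<open>
  A crude substitute for the triangle inequality in \<open>L\<^sup>2\<close>, sufficient for local boundedness.
\<close>
lemma norm_L2_square_le_twice:
  assumes v: "in_L2 v" and w: "in_L2 w"
  shows "(norm_L2 v)\<^sup>2 \<le> 2 * (norm_L2 (\<lambda>x. v x - w x))\<^sup>2 + 2 * (norm_L2 w)\<^sup>2"
proof -
  let ?M = "lebesgue_on {0<..<1::real}"
  have meas: "v \<in> borel_measurable ?M" "w \<in> borel_measurable ?M"
    and iv: "integrable ?M (\<lambda>x. (v x)\<^sup>2)" and iw: "integrable ?M (\<lambda>x. (w x)\<^sup>2)"
    using v w by (simp_all add: in_L2_def)
  have id: "integrable ?M (\<lambda>x. (v x - w x)\<^sup>2)"
  proof (rule Bochner_Integration.integrable_bound)
    show "integrable ?M (\<lambda>x. 2 * (v x)\<^sup>2 + 2 * (w x)\<^sup>2)" using iv iw by simp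
    show "(\<lambda>x. (v x - w x)\<^sup>2) \<in> borel_measurable ?M" using meas by measurable
    have "(v x - w x)\<^sup>2 \<le> 2 * (v x)\<^sup>2 + 2 * (w x)\<^sup>2" for x
      using zero_le_power2[of "v x + w x"] by (simp add: power2_sum power2_diff)
    then show "AE x in ?M. norm ((v x - w x)\<^sup>2) \<le> norm (2 * (v x)\<^sup>2 + 2 * (w x)\<^sup>2)"
      by simp
  qed
  have "(v x)\<^sup>2 \<le> 2 * (v x - w x)\<^sup>2 + 2 * (w x)\<^sup>2" for x
    using zero_le_power2[of "v x - 2 * w x"] by (simp add: power2_diff power_mult_distrib algebra_simps)
  then have "integral\<^sup>L ?M (\<lambda>x. (v x)\<^sup>2) \<le> integral\<^sup>L ?M (\<lambda>x. 2 * (v x - w x)\<^sup>2 + 2 * (w x)\<^sup>2)"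
    using iv iw id by (intro integral_mono) auto
  then show ?thesis
    using id iw by (simp add: norm_L2_square)
qed

text \<open>
  Without this bound the supremum of the norms would carry no information. Continuity gives a bound
  near every time, and Bolzano's principle glues the local bounds together.
\<close>
lemma continuous_into_L2_bdd_above:
  assumes f: "continuous_into_L2 f" and T: "T \<ge> 0"
  shows "bdd_above ((\<lambda>s. norm_L2 (profile f s)) ` {0..T})"
proof -
  let ?N = "\<lambda>s. norm_L2 (profile f s)"
  define P where "P a b \<longleftrightarrow> bdd_above (?N ` ({a..b} \<inter> {0..}))" for a b :: real
  have "P 0 T"
  proof (rule Bolzano[OF T])
    fix a b e assume "P a b" "P b e" "a \<le> b" "b \<le> e"
    moreover have "{a..e} \<inter> {0..} = ({a..b} \<inter> {0..}) \<union> ({b..e} \<inter> {0..})"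
      using \<open>a \<le> b\<close> \<open>b \<le> e\<close> by auto
    ultimately show "P a e"
      by (simp add: P_def image_Un)
  next
    fix x :: real assume x: "0 \<le> x" "x \<le> T"
    have "((\<lambda>s. norm_L2 (\<lambda>y. profile f s y - profile f x y)) \<longlongrightarrow> 0) (at x within {0..})"
      using f x by (auto simp: continuous_into_L2_def)
    then have "\<forall>\<^sub>F s in at x within {0..}. dist (norm_L2 (\<lambda>y. profile f s y - profile f x y)) 0 < 1"
      by (rule tendstoD) simp
    then obtain r where r: "r > 0"
      "\<And>s. s \<in> {0..} \<Longrightarrow> s \<noteq> x \<Longrightarrow> dist s x < r \<Longrightarrow>
         dist (norm_L2 (\<lambda>y. profile f s y - profile f x y)) 0 < 1"
      unfolding eventually_at by blast
    have "?N s \<le> sqrt (2 + 2 * (?N x)\<^sup>2)" if "s \<ge> 0" "dist s x < r" for s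
    proof (cases "s = x")
      case True
      then show ?thesis by (intro real_le_rsqrt) (simp add: norm_L2_nonneg)
    next
      case False
      then have "norm_L2 (\<lambda>y. profile f s y - profile f x y) \<le> 1"
        using r(2)[of s] that by (simp add: norm_L2_nonneg dist_real_def)
      then have "(norm_L2 (\<lambda>y. profile f s y - profile f x y))\<^sup>2 \<le> 1"
        by (simp add: norm_L2_nonneg power_le_one)
      moreover have "in_L2 (profile f s)" "in_L2 (profile f x)"
        using f that x by (auto simp: continuous_into_L2_def)
      ultimately show ?thesis
        using norm_L2_square_le_twice[of "profile f s" "profile f x"] by (intro real_le_rsqrt) linarith
    qed
    then have "P a b" if "a \<le> x" "x \<le> b" "b - a < r" for a b
      unfolding P_def using that
      by (intro bdd_aboveI2[where M = "sqrt (2 + 2 * (?N x)\<^sup>2)"]) (auto simp: dist_real_def)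
    then show "\<exists>d>0. \<forall>a b. a \<le> x \<and> x \<le> b \<and> b - a < d \<longrightarrow> P a b"
      using r(1) by blast
  qed
  moreover have "{0..T} \<inter> {0..} = {0..T}" by auto
  ultimately show ?thesis by (simp add: P_def)
qed

section \<open>Decay of the Lyapunov functional\<close>

text \<open>
  Along the first-order system \<open>p\<^sub>t = c\<^sup>2 q\<^sub>x - \<mu> p + f\<close>, \<open>q\<^sub>t = p\<^sub>x\<close> the density \<open>\<Phi>\<close> has the flux
  \<open>2 c\<^sup>2 p q + \<delta> x (p\<^sup>2 + c\<^sup>2 q\<^sup>2)\<close>. Multiplying density and flux by \<open>exp (\<delta> t / 6)\<close> puts the decay into a balance
  with only the inputs as sources. This replaces a Gronwall argument, for which the integral of \<open>\<Phi>\<close> would have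
  to be differentiable in time.
\<close>
lemma lyapunov_decay:
  fixes a c \<mu> \<delta> T M D :: real and p q f pt px qx :: "real \<times> real \<Rightarrow> real" and d :: "real \<Rightarrow> real"
  defines "\<Phi> \<equiv> \<lambda>z. (p z)\<^sup>2 + c\<^sup>2 * (q z)\<^sup>2 + 2 * \<delta> * snd z * p z * q z"
  assumes a: "a > 0" and c: "c > 0" and \<mu>: "\<mu> \<ge> 0"
    and \<delta>: "0 < \<delta>" "\<delta> \<le> c / 2" "\<delta> * \<mu> \<le> c\<^sup>2" "\<delta> * (2 * c\<^sup>2 * a\<^sup>2 + 1) \<le> a * c\<^sup>2"
    and contp: "continuous_on half_strip p" and contq: "continuous_on half_strip q"
    and contpt: "continuous_on open_half_strip pt" and contpx: "continuous_on open_half_strip px"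
    and contqx: "continuous_on open_half_strip qx" and contf: "continuous_on open_half_strip f"
    and dpt: "\<And>t x. (t, x) \<in> open_half_strip \<Longrightarrow> ((\<lambda>\<sigma>. p (\<sigma>, x)) has_real_derivative pt (t, x)) (at t)"
    and dpx: "\<And>t x. (t, x) \<in> open_half_strip \<Longrightarrow> ((\<lambda>y. p (t, y)) has_real_derivative px (t, x)) (at x)"
    and dqt: "\<And>t x. (t, x) \<in> open_half_strip \<Longrightarrow> ((\<lambda>\<sigma>. q (\<sigma>, x)) has_real_derivative px (t, x)) (at t)"
    and dqx: "\<And>t x. (t, x) \<in> open_half_strip \<Longrightarrow> ((\<lambda>y. q (t, y)) has_real_derivative qx (t, x)) (at x)"
    and pde: "\<And>z. z \<in> open_half_strip \<Longrightarrow> pt z = c\<^sup>2 * qx z - \<mu> * p z + f z"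
    and bc0: "\<And>t. t > 0 \<Longrightarrow> p (t, 0) = 0"
    and bc1: "\<And>t. t > 0 \<Longrightarrow> q (t, 1) = - a * p (t, 1) + d t"
    and T: "T \<ge> 0"
    and fM: "\<And>t l r. t \<in> {0..T} \<Longrightarrow> 0 < l \<Longrightarrow> l \<le> r \<Longrightarrow> r < 1 \<Longrightarrow>
               integral {l..r} (\<lambda>x. (f (t, x))\<^sup>2) \<le> M\<^sup>2"
    and dD: "\<And>t. t \<in> {0..T} \<Longrightarrow> \<bar>d t\<bar> \<le> D"
  shows "integral {0..1} (\<lambda>x. \<Phi> (T, x)) \<le> exp (- (\<delta> / 6) * T) * integral {0..1} (\<lambda>x. \<Phi> (0, x))
           + 6 / \<delta> * ((8 / \<delta> + 8 * \<delta> / c\<^sup>2) * M\<^sup>2 + (c\<^sup>2 / a + 2 * \<delta> * c\<^sup>2) * D\<^sup>2)"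
proof -
  define \<kappa> where "\<kappa> = \<delta> / 6"
  define Cf where "Cf = 8 / \<delta> + 8 * \<delta> / c\<^sup>2"
  define Cd where "Cd = c\<^sup>2 / a + 2 * \<delta> * c\<^sup>2"
  define K where "K = Cf * M\<^sup>2 + Cd * D\<^sup>2"
  \<comment> \<open>\<open>P\<close> and \<open>Q\<close> are the weighted density and flux, \<open>A = P\<^sub>t\<close> and \<open>B = Q\<^sub>x\<close>.\<close>
  define P where "P z = exp (\<kappa> * fst z) * \<Phi> z" for z
  define A where "A z = exp (\<kappa> * fst z) * (\<kappa> * \<Phi> z + 2 * p z * pt z + 2 * c\<^sup>2 * q z * px z
      + 2 * \<delta> * snd z * (pt z * q z + p z * px z))" for z
  define Q where "Q z = exp (\<kappa> * fst z) * (2 * c\<^sup>2 * p z * q z + \<delta> * snd z * ((p z)\<^sup>2 + c\<^sup>2 * (q z)\<^sup>2))" for z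
  define B where "B z = exp (\<kappa> * fst z) * (2 * c\<^sup>2 * (px z * q z + p z * qx z)
      + \<delta> * ((p z)\<^sup>2 + c\<^sup>2 * (q z)\<^sup>2) + 2 * \<delta> * snd z * (p z * px z + c\<^sup>2 * q z * qx z))" for z
  define g where "g z = exp (\<kappa> * fst z) * (Cf * (f z)\<^sup>2)" for z
  define V where "V t = integral {0..1} (\<lambda>x. P (t, x))" for t
  have \<kappa>: "\<kappa> > 0" and Cf: "Cf \<ge> 0" and Cd: "Cd \<ge> 0"
    using \<delta> a c by (simp_all add: \<kappa>_def Cf_def Cd_def)
  have K: "K \<ge> 0" using Cf Cd by (simp add: K_def)
  note sub = open_half_strip_subset
  note contpi = continuous_on_subset[OF contp sub] and contqi = continuous_on_subset[OF contq sub]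
  have cont\<Phi>: "continuous_on half_strip \<Phi>"
    unfolding \<Phi>_def by (intro continuous_intros contp contq)
  have contP: "continuous_on half_strip P"
    unfolding P_def by (intro continuous_intros cont\<Phi>)
  have contQ: "continuous_on half_strip Q"
    unfolding Q_def by (intro continuous_intros contp contq)
  have contA: "continuous_on open_half_strip A"
    unfolding A_def
    by (intro continuous_intros continuous_on_subset[OF cont\<Phi> sub] contpi contqi contpt contpx)
  have contB: "continuous_on open_half_strip B"
    unfolding B_def by (intro continuous_intros contpi contqi contqx contpx)
  have contg: "continuous_on open_half_strip g"
    unfolding g_def by (intro continuous_intros contf)
  have dP: "((\<lambda>\<sigma>. P (\<sigma>, x)) has_real_derivative A (t, x)) (at t)"
    if "(t, x) \<in> open_half_strip" for t x
    unfolding P_def A_def \<Phi>_def fst_conv snd_conv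
    by (rule derivative_eq_intros dpt dqt that refl | simp)+
       (simp add: algebra_simps power2_eq_square)
  have dQ: "((\<lambda>y. Q (t, y)) has_real_derivative B (t, x)) (at x)"
    if "(t, x) \<in> open_half_strip" for t x
    unfolding Q_def B_def \<Phi>_def fst_conv snd_conv
    by (rule derivative_eq_intros dpx dqx that refl | simp)+
       (simp add: algebra_simps power2_eq_square)
  have AB: "A z \<le> B z + g z" if z: "z \<in> open_half_strip" for z
  proof -
    have x: "0 \<le> snd z" "snd z \<le> 1" using z by (auto simp: open_half_strip_def)
    let ?r = "\<kappa> * \<Phi> z - \<delta> * ((p z)\<^sup>2 + c\<^sup>2 * (q z)\<^sup>2) - 2 * \<mu> * (p z)\<^sup>2
      - 2 * \<delta> * \<mu> * snd z * p z * q z + 2 * (p z + \<delta> * snd z * q z) * f z"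
    have "A z - B z = exp (\<kappa> * fst z) * ?r"
      unfolding A_def B_def pde[OF z] by (simp add: algebra_simps power2_eq_square)
    also have "\<dots> \<le> exp (\<kappa> * fst z) * (Cf * (f z)\<^sup>2)"
      using energy_dissipation[OF c \<mu> \<delta>(1-3) x, of "p z" "q z" "f z"]
      by (intro mult_left_mono) (auto simp: \<kappa>_def Cf_def \<Phi>_def)
    finally show ?thesis by (simp add: g_def)
  qed
  \<comment> \<open>The balance is available from positive times on only; the initial time is reached by
    continuity of \<open>V\<close> afterwards.\<close>
  have growth: "V T - V s \<le> exp (\<kappa> * T) * K / \<kappa>" if s: "0 < s" "s \<le> T" for s
  proof -
    have gm: "integral {l..r} (\<lambda>x. g (t, x)) \<le> exp (\<kappa> * t) * (Cf * M\<^sup>2)"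
      if "t \<in> {s..T}" "0 < l" "l \<le> r" "r < 1" for t l r
    proof -
      have "integral {l..r} (\<lambda>x. g (t, x)) = exp (\<kappa> * t) * (Cf * integral {l..r} (\<lambda>x. (f (t, x))\<^sup>2))"
        by (simp add: g_def)
      also have "\<dots> \<le> exp (\<kappa> * t) * (Cf * M\<^sup>2)"
        using fM[of t l r] that s Cf by (intro mult_left_mono) auto
      finally show ?thesis .
    qed
    have "V T - V s \<le> integral {s..T} (\<lambda>t. Q (t, 1) - Q (t, 0) + exp (\<kappa> * t) * (Cf * M\<^sup>2))"
      unfolding V_def
      by (rule half_strip_balance[OF s contP contQ contA contB contg _ dP dQ AB gm])
         (auto intro!: continuous_intros)
    also have "\<dots> \<le> integral {s..T} (\<lambda>t. exp (\<kappa> * t) * K)"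
    proof (rule integral_le)
      show "(\<lambda>t. Q (t, 1) - Q (t, 0) + exp (\<kappa> * t) * (Cf * M\<^sup>2)) integrable_on {s..T}"
        using s by (intro integrable_continuous_real continuous_intros
            continuous_on_compose2[OF contQ, where f = "\<lambda>t. (t, _)"]) (auto simp: half_strip_def)
      show "(\<lambda>t. exp (\<kappa> * t) * K) integrable_on {s..T}"
        by (intro integrable_continuous_real continuous_intros)
    next
      fix t assume t: "t \<in> {s..T}"
      have "Q (t, 0) = 0"
        using bc0[of t] s t by (simp add: Q_def)
      moreover have "Q (t, 1) \<le> exp (\<kappa> * t) * (Cd * (d t)\<^sup>2)"
        using boundary_flux_bound[OF a c \<delta>(1,4) bc1[of t]] s t
        by (auto simp: Q_def Cd_def intro!: mult_left_mono)
      moreover have "(d t)\<^sup>2 \<le> D\<^sup>2"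
        using dD[of t] s t power_mono[of "\<bar>d t\<bar>" D 2] by auto
      then have "exp (\<kappa> * t) * (Cd * (d t)\<^sup>2) \<le> exp (\<kappa> * t) * (Cd * D\<^sup>2)"
        using Cd by (intro mult_left_mono) auto
      ultimately show "Q (t, 1) - Q (t, 0) + exp (\<kappa> * t) * (Cf * M\<^sup>2) \<le> exp (\<kappa> * t) * K"
        by (simp add: K_def algebra_simps)
    qed
    also have "\<dots> = exp (\<kappa> * T) * K / \<kappa> - exp (\<kappa> * s) * K / \<kappa>"
      using \<kappa> s by (intro integral_unique fundamental_theorem_of_calculus)
        (auto simp flip: has_real_derivative_iff_has_vector_derivative intro!: derivative_eq_intros)
    also have "\<dots> \<le> exp (\<kappa> * T) * K / \<kappa>"
      using K \<kappa> by simp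
    finally show ?thesis .
  qed
  have V0: "V T - V 0 \<le> exp (\<kappa> * T) * K / \<kappa>"
  proof (cases "T = 0")
    case True
    then show ?thesis using K \<kappa> by simp
  next
    case False
    have "continuous_on {0..T} (\<lambda>t. integral (cbox 0 1) (\<lambda>x. P (t, x)))"
      by (intro integral_continuous_on_param)
         (auto simp: half_strip_def intro!: continuous_on_subset[OF contP])
    then have "continuous_on (closure {0<..<T}) (\<lambda>t. V T - V t)"
      using False T by (simp add: V_def continuous_on_diff)
    then show ?thesis
      by (rule continuous_le_on_closure) (use growth False T in auto)
  qed
  define W where "W t = integral {0..1} (\<lambda>x. \<Phi> (t, x))" for t
  have VW: "V t = exp (\<kappa> * t) * W t" for t
    by (simp add: V_def W_def P_def)
  have "W T = exp (- \<kappa> * T) * V T"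
    by (simp add: VW flip: exp_add mult.assoc)
  also have "\<dots> \<le> exp (- \<kappa> * T) * (V 0 + exp (\<kappa> * T) * K / \<kappa>)"
    using V0 by (intro mult_left_mono) auto
  also have "\<dots> = exp (- \<kappa> * T) * W 0 + K / \<kappa>"
    by (simp add: VW distrib_left flip: exp_add mult.assoc)
  finally show ?thesis
    by (simp add: W_def K_def Cf_def Cd_def \<kappa>_def mult_ac)
qed

text \<open>
  A classical solution of the wave equation supplies such a first-order system; the equation
  \<open>q\<^sub>t = p\<^sub>x\<close> is the equality of the mixed derivatives of \<open>u\<close>.
\<close>
lemma solution_lyapunov_decay:
  fixes a c \<mu> \<delta> T M D :: real and f u :: "real \<times> real \<Rightarrow> real" and d :: "real \<Rightarrow> real"
  defines "\<Phi> \<equiv> \<lambda>z. (D_t u z)\<^sup>2 + c\<^sup>2 * (D_x u z)\<^sup>2 + 2 * \<delta> * snd z * D_t u z * D_x u z"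
  assumes a: "a > 0" and c: "c > 0" and \<mu>: "\<mu> \<ge> 0"
    and \<delta>: "0 < \<delta>" "\<delta> \<le> c / 2" "\<delta> * \<mu> \<le> c\<^sup>2" "\<delta> * (2 * c\<^sup>2 * a\<^sup>2 + 1) \<le> a * c\<^sup>2"
    and f: "continuous_into_L2 f" "continuous_on open_half_strip f"
    and u1: "Ck_on 1 half_strip u" and u2: "Ck_on 2 open_half_strip u"
    and pde: "\<And>t x. t > 0 \<Longrightarrow> 0 < x \<Longrightarrow> x < 1 \<Longrightarrow>
                D_tt u (t, x) = c\<^sup>2 * D_xx u (t, x) - \<mu> * D_t u (t, x) + f (t, x)"
    and bc0: "\<And>t. t > 0 \<Longrightarrow> u (t, 0) = 0"
    and bc1: "\<And>t. t > 0 \<Longrightarrow> D_x u (t, 1) = - a * D_t u (t, 1) + d t"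
    and T: "T \<ge> 0"
    and fM: "\<And>t. t \<in> {0..T} \<Longrightarrow> norm_L2 (profile f t) \<le> M"
    and dD: "\<And>t. t \<in> {0..T} \<Longrightarrow> \<bar>d t\<bar> \<le> D"
  shows "integral {0..1} (\<lambda>x. \<Phi> (T, x)) \<le> exp (- (\<delta> / 6) * T) * integral {0..1} (\<lambda>x. \<Phi> (0, x))
           + 6 / \<delta> * ((8 / \<delta> + 8 * \<delta> / c\<^sup>2) * M\<^sup>2 + (c\<^sup>2 / a + 2 * \<delta> * c\<^sup>2) * D\<^sup>2)"
proof -
  define e1 e2 :: "real \<times> real" where e_def: "e1 = (1, 0)" "e2 = (0, 1)"
  have e: "e1 \<in> Basis" "e2 \<in> Basis"
    by (auto simp: e_def Basis_prod_def)
  note contp = C1_half_strip_deriv_on(1)[OF u1 e(1), unfolded e_def, folded D_t_def]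
   and contq = C1_half_strip_deriv_on(1)[OF u1 e(2), unfolded e_def, folded D_x_def]
   and p_eq = C1_half_strip_deriv_on(2)[OF u1 e(1), unfolded e_def, folded D_t_def]
   and q_eq = C1_half_strip_deriv_on(2)[OF u1 e(2), unfolded e_def, folded D_x_def]
  have differentiable: "(\<lambda>h. iter_partial bs u (z + h *\<^sub>R b)) field_differentiable (at 0)"
    if "set bs \<subseteq> {e1, e2}" "length bs < 2" "b \<in> {e1, e2}" "z \<in> open_half_strip" for bs b z
    using u2 that e unfolding Ck_on_def interior_open_half_strip by blast
  have cont: "continuous_on open_half_strip (iter_partial bs u)"
    if bs: "set bs \<subseteq> {e1, e2}" "length bs \<le> 2" for bs
  proof -
    have "set bs \<subseteq> Basis" using bs e by auto
    then obtain g where "continuous_on open_half_strip g"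
      "\<And>z. z \<in> open_half_strip \<Longrightarrow> g z = iter_partial bs u z"
      using u2 bs(2) unfolding Ck_on_def interior_open_half_strip by blast
    then show ?thesis by (simp cong: continuous_on_cong)
  qed
  have dt: "((\<lambda>\<sigma>. iter_partial bs u (\<sigma>, x)) has_real_derivative iter_partial (e1 # bs) u (t, x)) (at t)"
    if "(t, x) \<in> open_half_strip" "set bs \<subseteq> {e1, e2}" "length bs < 2" for t x bs
    using has_real_derivative_partial_t[of "iter_partial bs u" t x]
      differentiable[of bs e1 "(t, x)"] that by (simp add: e_def)
  have dx: "((\<lambda>y. iter_partial bs u (t, y)) has_real_derivative iter_partial (e2 # bs) u (t, x)) (at x)"
    if "(t, x) \<in> open_half_strip" "set bs \<subseteq> {e1, e2}" "length bs < 2" for t x bs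
    using has_real_derivative_partial_x[of "iter_partial bs u" t x]
      differentiable[of bs e2 "(t, x)"] that by (simp add: e_def)
  \<comment> \<open>\<open>D_t u\<close> and \<open>D_x u\<close> agree with the iterated partial derivatives in the interior only, so
    derivatives pass from one to the other by locality.\<close>
  have transfer_t: "((\<lambda>\<sigma>. w (\<sigma>, x)) has_real_derivative D) (at t)"
    if "((\<lambda>\<sigma>. v (\<sigma>, x)) has_real_derivative D) (at t)" "(t, x) \<in> open_half_strip"
      "\<And>z. z \<in> open_half_strip \<Longrightarrow> w z = v z" for v w :: "real \<times> real \<Rightarrow> real" and t x D
    by (rule has_field_derivative_transform_within_open[OF that(1), of "{0<..}"])
       (use that in \<open>auto simp: open_half_strip_def\<close>)
  have transfer_x: "((\<lambda>y. w (t, y)) has_real_derivative D) (at x)"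
    if "((\<lambda>y. v (t, y)) has_real_derivative D) (at x)" "(t, x) \<in> open_half_strip"
      "\<And>z. z \<in> open_half_strip \<Longrightarrow> w z = v z" for v w :: "real \<times> real \<Rightarrow> real" and t x D
    by (rule has_field_derivative_transform_within_open[OF that(1), of "{0<..<1}"])
       (use that in \<open>auto simp: open_half_strip_def\<close>)
  have mixed: "iter_partial [e2, e1] u z = iter_partial [e1, e2] u z" if "z \<in> open_half_strip" for z
    by (rule mixed_partials_eq[OF open_open_half_strip that, where w = "iter_partial [] u"
          and wt = "iter_partial [e1] u" and wx = "iter_partial [e2] u"])
       (intro dt dx cont; simp)+
  show ?thesis
    unfolding \<Phi>_def
  proof (rule lyapunov_decay[OF a c \<mu> \<delta> contp contq _ _ _ f(2), where d = d
        and pt = "iter_partial [e1, e1] u" and px = "iter_partial [e2, e1] u"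
        and qx = "iter_partial [e2, e2] u"])
    fix t x :: real assume tx: "(t, x) \<in> open_half_strip"
    show "((\<lambda>\<sigma>. D_t u (\<sigma>, x)) has_real_derivative iter_partial [e1, e1] u (t, x)) (at t)"
      by (rule transfer_t[where v = "iter_partial [e1] u"])
         (use tx p_eq dt[of t x "[e1]"] in \<open>auto simp: e_def\<close>)
    show "((\<lambda>y. D_t u (t, y)) has_real_derivative iter_partial [e2, e1] u (t, x)) (at x)"
      by (rule transfer_x[where v = "iter_partial [e1] u"])
         (use tx p_eq dx[of t x "[e1]"] in \<open>auto simp: e_def\<close>)
    have "((\<lambda>\<sigma>. D_x u (\<sigma>, x)) has_real_derivative iter_partial [e1, e2] u (t, x)) (at t)"
      by (rule transfer_t[where v = "iter_partial [e2] u"])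
         (use tx q_eq dt[of t x "[e2]"] in \<open>auto simp: e_def\<close>)
    then show "((\<lambda>\<sigma>. D_x u (\<sigma>, x)) has_real_derivative iter_partial [e2, e1] u (t, x)) (at t)"
      by (simp only: mixed[OF tx])
    show "((\<lambda>y. D_x u (t, y)) has_real_derivative iter_partial [e2, e2] u (t, x)) (at x)"
      by (rule transfer_x[where v = "iter_partial [e2] u"])
         (use tx q_eq dx[of t x "[e2]"] in \<open>auto simp: e_def\<close>)
  next
    fix z assume "z \<in> open_half_strip"
    then show "iter_partial [e1, e1] u z = c\<^sup>2 * iter_partial [e2, e2] u z - \<mu> * D_t u z + f z"
      using pde[of "fst z" "snd z"] by (auto simp: D_tt_def D_xx_def e_def open_half_strip_def)
  next
    fix t :: real assume t: "t > 0"
    have du: "((\<lambda>\<sigma>. u (\<sigma>, x)) has_real_derivative D_t u (t, x)) (at t)"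
      if "(t, x) \<in> open_half_strip" for t x
      using dt[of t x "[]"] that p_eq by (simp add: e_def)
    have "continuous_on half_strip u" using u1 by (simp add: Ck_on_def)
    then show "D_t u (t, 0) = 0"
      using contp du bc0 t by (rule time_deriv_zero_on_boundary)
  next
    fix t l r :: real assume t: "t \<in> {0..T}" and lr: "0 < l" "l \<le> r" "r < 1"
    have "in_L2 (profile f t)" using f(1) t by (simp add: continuous_into_L2_def)
    then have "integral {l..r} (\<lambda>x. (f (t, x))\<^sup>2) \<le> (norm_L2 (profile f t))\<^sup>2"
      using integral_square_le_norm_L2[of "profile f t" l r] lr by (simp add: profile_def)
    also have "\<dots> \<le> M\<^sup>2"
      using fM[OF t] by (intro power_mono norm_L2_nonneg)
    finally show "integral {l..r} (\<lambda>x. (f (t, x))\<^sup>2) \<le> M\<^sup>2" .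
  qed (assumption | rule cont bc1 T dD | simp)+
qed

section \<open>Input-to-state stability\<close>

theorem theorem1:
  fixes a c \<mu> :: real
  assumes "a > 0" and "c > 0" and "\<mu> \<ge> 0"
  shows "\<exists>\<omega> G \<gamma>\<^sub>1 \<gamma>\<^sub>2 :: real. \<omega> > 0 \<and> G > 0 \<and> \<gamma>\<^sub>1 > 0 \<and> \<gamma>\<^sub>2 > 0 \<and>
    (\<forall>(f :: real \<times> real \<Rightarrow> real) (d :: real \<Rightarrow> real) (u :: real \<times> real \<Rightarrow> real).
       continuous_into_L2 f \<and> continuous_on open_half_strip f \<and>
       continuous_on {0..} d \<and>
       Ck_on 1 half_strip u \<and> Ck_on 2 open_half_strip u \<and>
       (\<forall>t x. t > 0 \<and> 0 < x \<and> x < 1 \<longrightarrow>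
          D_tt u (t, x) = c\<^sup>2 * D_xx u (t, x) - \<mu> * D_t u (t, x) + f (t, x)) \<and>
       (\<forall>t>0. u (t, 0) = 0) \<and>
       (\<forall>t>0. D_x u (t, 1) = - a * D_t u (t, 1) + d t)
       \<longrightarrow>
       (\<forall>t\<ge>0.
          sqrt ((norm_L2 (profile (D_t u) t))\<^sup>2 + (norm_L2 (profile (D_x u) t))\<^sup>2)
          \<le> G * exp (- \<omega> * t) *
               sqrt ((norm_L2 (profile (D_t u) 0))\<^sup>2 + (norm_L2 (profile (D_x u) 0))\<^sup>2)
             + \<gamma>\<^sub>1 * (SUP s\<in>{0..t}. norm_L2 (profile f s))
             + \<gamma>\<^sub>2 * (SUP s\<in>{0..t}. \<bar>d s\<bar>)))"
proof -
  define k where "k = 2 * c\<^sup>2 * a\<^sup>2 + 1"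
  define \<delta> where "\<delta> = min (c / 2) (min (c\<^sup>2 / (\<mu> + 1)) (a * c\<^sup>2 / k))"
  have k: "k > 0" by (simp add: k_def add_nonneg_pos)
  \<comment> \<open>The three bounds keep the cross term subordinate to the energy, its damping subordinate to
    the dissipation that it creates, and its boundary flux subordinate to the loss at \<open>x = 1\<close>.\<close>
  have \<delta>: "0 < \<delta>" "\<delta> \<le> c / 2" "\<delta> \<le> c\<^sup>2 / (\<mu> + 1)" "\<delta> \<le> a * c\<^sup>2 / k"
    using assms k by (simp add: \<delta>_def) (unfold \<delta>_def, linarith+)
  have \<delta>\<mu>: "\<delta> * \<mu> \<le> c\<^sup>2"
    using \<delta>(1,3) assms by (simp add: field_simps)
  have \<delta>k: "\<delta> * (2 * c\<^sup>2 * a\<^sup>2 + 1) \<le> a * c\<^sup>2"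
    using \<delta>(4) k by (subst k_def[symmetric]) (simp add: pos_le_divide_eq)
  define lo where "lo = min 1 (c\<^sup>2) / 2"
  define hi where "hi = 3 / 2 * max 1 (c\<^sup>2)"
  define Cf where "Cf = 6 / \<delta> * (8 / \<delta> + 8 * \<delta> / c\<^sup>2)"
  define Cd where "Cd = 6 / \<delta> * (c\<^sup>2 / a + 2 * \<delta> * c\<^sup>2)"
  have pos: "lo > 0" "hi > 0" "Cf > 0" "Cd > 0"
    using assms \<delta>(1) by (simp_all add: lo_def hi_def Cf_def Cd_def add_pos_pos)
  have estimate: "sqrt ((norm_L2 (profile (D_t u) t))\<^sup>2 + (norm_L2 (profile (D_x u) t))\<^sup>2)
          \<le> sqrt (hi / lo) * exp (- (\<delta> / 12) * t) *
               sqrt ((norm_L2 (profile (D_t u) 0))\<^sup>2 + (norm_L2 (profile (D_x u) 0))\<^sup>2)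
             + sqrt (Cf / lo) * (SUP s\<in>{0..t}. norm_L2 (profile f s))
             + sqrt (Cd / lo) * (SUP s\<in>{0..t}. \<bar>d s\<bar>)"
    if f: "continuous_into_L2 f" "continuous_on open_half_strip f"
      and d: "continuous_on {0..} d"
      and u: "Ck_on 1 half_strip u" "Ck_on 2 open_half_strip u"
      and pde: "\<forall>t x. t > 0 \<and> 0 < x \<and> x < 1 \<longrightarrow>
          D_tt u (t, x) = c\<^sup>2 * D_xx u (t, x) - \<mu> * D_t u (t, x) + f (t, x)"
      and bc0: "\<forall>t>0. u (t, 0) = 0"
      and bc1: "\<forall>t>0. D_x u (t, 1) = - a * D_t u (t, 1) + d t"
      and t: "t \<ge> 0" for f u :: "real \<times> real \<Rightarrow> real" and d :: "real \<Rightarrow> real" and t :: real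
  proof -
    define M where "M = (SUP s\<in>{0..t}. norm_L2 (profile f s))"
    define D where "D = (SUP s\<in>{0..t}. \<bar>d s\<bar>)"
    define N where "N s = (norm_L2 (profile (D_t u) s))\<^sup>2 + (norm_L2 (profile (D_x u) s))\<^sup>2" for s
    define W where "W s = integral {0..1} (\<lambda>x. (D_t u (s, x))\<^sup>2 + c\<^sup>2 * (D_x u (s, x))\<^sup>2
        + 2 * \<delta> * x * D_t u (s, x) * D_x u (s, x))" for s
    have fM: "norm_L2 (profile f s) \<le> M" if "s \<in> {0..t}" for s
      unfolding M_def by (rule cSUP_upper[OF that continuous_into_L2_bdd_above[OF f(1) t]])
    have "continuous_on {0..t} (\<lambda>s. \<bar>d s\<bar>)"
      using d by (intro continuous_intros) (auto elim: continuous_on_subset)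
    then have "bdd_above ((\<lambda>s. \<bar>d s\<bar>) ` {0..t})"
      by (intro bounded_imp_bdd_above compact_imp_bounded compact_continuous_image) auto
    then have dD: "\<bar>d s\<bar> \<le> D" if "s \<in> {0..t}" for s
      unfolding D_def using that by (rule cSUP_upper[rotated])
    have M0: "0 \<le> M" using fM[of 0] norm_L2_nonneg[of "profile f 0"] t by simp
    have D0: "0 \<le> D" using dD[of 0] t by simp
    have N0: "N s \<ge> 0" for s by (simp add: N_def)
    have "W t \<le> exp (- (\<delta> / 6) * t) * W 0
        + 6 / \<delta> * ((8 / \<delta> + 8 * \<delta> / c\<^sup>2) * M\<^sup>2 + (c\<^sup>2 / a + 2 * \<delta> * c\<^sup>2) * D\<^sup>2)"
      unfolding W_def
      by (rule solution_lyapunov_decay[OF assms \<delta>(1,2) \<delta>\<mu> \<delta>k f u, unfolded snd_conv])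
         (use pde bc0 bc1 t fM dD in auto)
    also have "\<dots> = exp (- (\<delta> / 6) * t) * W 0 + (Cf * M\<^sup>2 + Cd * D\<^sup>2)"
      by (simp only: Cf_def Cd_def distrib_left distrib_right mult.assoc)
    finally have W_decay: "W t \<le> exp (- (\<delta> / 6) * t) * W 0 + (Cf * M\<^sup>2 + Cd * D\<^sup>2)" .
    have contp: "continuous_on {0..1} (\<lambda>x. D_t u (s, x))"
      and contq: "continuous_on {0..1} (\<lambda>x. D_x u (s, x))" if "s \<ge> 0" for s
      unfolding D_t_def D_x_def
      by (rule continuous_on_compose2[OF C1_half_strip_deriv_on(1)[OF u(1)]];
          use that in \<open>auto simp: Basis_prod_def half_strip_def intro!: continuous_intros\<close>)+
    have N_eq: "N s = integral {0..1} (\<lambda>x. (D_t u (s, x))\<^sup>2 + (D_x u (s, x))\<^sup>2)" if "s \<ge> 0" for s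
      using contp[OF that] contq[OF that] unfolding N_def profile_def
      by (subst integral_add) (auto simp: norm_L2_continuous intro!: integrable_continuous_real continuous_intros)
    have NW: "lo * N s \<le> W s" and WN: "W s \<le> hi * N s" if s: "s \<ge> 0" for s
    proof -
      note cont = contp[OF s] contq[OF s]
      have "integral {0..1} (\<lambda>x. lo * ((D_t u (s, x))\<^sup>2 + (D_x u (s, x))\<^sup>2)) \<le> W s"
        unfolding W_def lo_def
        by (intro integral_le integrable_continuous_real continuous_intros cont
            lyapunov_density_equivalent(1) assms \<delta>) auto
      then show "lo * N s \<le> W s" by (simp add: N_eq[OF s])
      have "W s \<le> integral {0..1} (\<lambda>x. hi * ((D_t u (s, x))\<^sup>2 + (D_x u (s, x))\<^sup>2))"
        unfolding W_def hi_def
        by (intro integral_le integrable_continuous_real continuous_intros cont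
            lyapunov_density_equivalent(2) assms \<delta>) auto
      then show "W s \<le> hi * N s" by (simp add: N_eq[OF s])
    qed
    \<comment> \<open>The bound is additive in the squares; \<open>X\<^sup>2 + Y\<^sup>2 + Z\<^sup>2 \<le> (X + Y + Z)\<^sup>2\<close> for nonnegative summands
      separates the contributions, and the square root halves the rate \<open>\<delta> / 6\<close>.\<close>
    let ?x = "sqrt (hi / lo) * exp (- (\<delta> / 12) * t) * sqrt (N 0)"
    let ?y = "sqrt (Cf / lo) * M" and ?z = "sqrt (Cd / lo) * D"
    have xyz: "?x \<ge> 0" "?y \<ge> 0" "?z \<ge> 0"
      using pos N0 M0 D0 by auto
    have exp_sq: "(exp (- (\<delta> * t / 12)))\<^sup>2 = exp (- (\<delta> * t / 6))"
      by (simp flip: exp_of_nat_mult)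
    have sum_sq: "X\<^sup>2 + Y\<^sup>2 + Z\<^sup>2 \<le> (X + Y + Z)\<^sup>2" if "X \<ge> 0" "Y \<ge> 0" "Z \<ge> 0" for X Y Z :: real
    proof -
      have "(X + Y + Z)\<^sup>2 = X\<^sup>2 + Y\<^sup>2 + Z\<^sup>2 + 2 * (X * Y + Y * Z + X * Z)"
        by (simp add: power2_eq_square algebra_simps)
      with that show ?thesis by simp
    qed
    have "lo * N t \<le> exp (- (\<delta> / 6) * t) * W 0 + (Cf * M\<^sup>2 + Cd * D\<^sup>2)"
      using NW[OF t] W_decay by linarith
    also have "\<dots> \<le> exp (- (\<delta> / 6) * t) * (hi * N 0) + (Cf * M\<^sup>2 + Cd * D\<^sup>2)"
      using WN[of 0] by (intro add_right_mono mult_left_mono) auto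
    finally have "N t \<le> hi / lo * exp (- (\<delta> / 6) * t) * N 0 + Cf / lo * M\<^sup>2 + Cd / lo * D\<^sup>2"
      using pos by (simp add: field_simps)
    also have "\<dots> = ?x\<^sup>2 + ?y\<^sup>2 + ?z\<^sup>2"
      using pos N0[of 0] by (simp add: power_mult_distrib exp_sq)
    also have "\<dots> \<le> (?x + ?y + ?z)\<^sup>2"
      using xyz by (rule sum_sq)
    finally have "sqrt (N t) \<le> ?x + ?y + ?z"
      using xyz by (intro real_le_lsqrt) auto
    then show ?thesis
      by (simp add: N_def M_def D_def)
  qed
  show ?thesis
  proof (rule exI[of _ "\<delta> / 12"], rule exI[of _ "sqrt (hi / lo)"], rule exI[of _ "sqrt (Cf / lo)"],
      rule exI[of _ "sqrt (Cd / lo)"], intro conjI allI impI; (elim conjE)?)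
  qed (rule estimate; assumption | use \<delta>(1) pos in simp)+
qed

end
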